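(* Let $T_1,T_2,\ldots$ be a sequence of (finite) trees such that $|T_n| \to \infty$ as $n \to \infty$. For every integer $k \geq 4$, the following four statements are equivalent: (M1) $\lim_{n \to \infty} p_1^{(k)}(T_n) = 0$; (M2) $\lim_{n \to \infty} \frac{1}{|T_n|} Z_k(T_n) = \infty$; (M3) $\lim_{n \to \infty} \frac{1}{|T_n|} \sum_{v \in V(T_n)} d(v)^{k-1} = \infty$; (M4) $\lim_{n \to \infty} p_2^{(k)}(T_n) = 1$.
   Context: All trees are finite. For a tree $T$, $V(T)$ is its vertex set, $|T|$ its number of vertices, and $d(v)$ the degree of a vertex $v$ in $T$. For trees $S$ and $T$, $c(S,T)$ is the number of vertex subsets of $T$ that induce a tree isomorphic to $S$. $Z_k(T)$ is the number of $k$-vertex subsets of $V(T)$ that induce a tree (the number of $k$-vertex subtrees of $T$). $P_k$ denotes the path on $k$ vertices and $S_k$ the star on $k$ vertices (one center and $k-1$ leaves). Set $p_1^{(k)}(T) = c(P_k,T)/Z_k(T)$ and $p_2^{(k)}(T) = c(S_k,T)/Z_k(T)$, the proportions of paths and of stars among the $k$-vertex subtrees of $T$. (These are defined whenever $|T| \geq k$, hence for $T_n$ with $n$ sufficiently large.) *)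

theory Defs
  imports Complex_Main "Graph_Theory.Graph_Theory"
begin

text \<open>
  Finite simple graphs are the symmetric digraphs of the locale \<open>graph\<close>: every edge is a pair of
  opposite arcs, so the degree of a vertex is its \<^const>\<open>out_degree\<close>. The library predicates
  \<^const>\<open>forest\<close> and \<^const>\<open>tree\<close> do not fit this model, since the two arcs of a single edge form a
  directed cycle of length 2. In a \<open>graph\<close>, which has neither loops nor parallel arcs, the cycles of
  length at least 3 are exactly the cycles of the undirected graph.
\<close>

definition is_tree :: "('a, 'b) pre_digraph \<Rightarrow> bool" where
  "is_tree G \<longleftrightarrow> graph G \<and> Digraph_Component.connected G \<and>
     \<not> (\<exists>p. pre_digraph.cycle G p \<and> 3 \<le> length p)"

definition path_graph :: "nat \<Rightarrow> nat pair_pre_digraph" where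
  "path_graph k = \<lparr> pverts = {..<k},
     parcs = {(i, j). i < k \<and> j < k \<and> (j = Suc i \<or> i = Suc j)} \<rparr>"

definition star_graph :: "nat \<Rightarrow> nat pair_pre_digraph" where
  "star_graph k = \<lparr> pverts = {..<k},
     parcs = {(i, j). i < k \<and> j < k \<and> i \<noteq> j \<and> (i = 0 \<or> j = 0)} \<rparr>"

definition induced_copies :: "('c, 'd) pre_digraph \<Rightarrow> ('a, 'b) pre_digraph \<Rightarrow> nat" where
  "induced_copies S T = card {U. U \<subseteq> verts T \<and> is_tree (T \<restriction> U) \<and> digraph_iso (T \<restriction> U) S}"

definition subtree_count :: "nat \<Rightarrow> ('a, 'b) pre_digraph \<Rightarrow> nat" where
  "subtree_count k T = card {U. U \<subseteq> verts T \<and> card U = k \<and> is_tree (T \<restriction> U)}"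

text \<open>
  Both proportions are 0, by division by zero, when the tree has fewer than \<open>k\<close> vertices.
\<close>

definition path_proportion :: "nat \<Rightarrow> ('a, 'b) pre_digraph \<Rightarrow> real" where
  "path_proportion k T =
     real (induced_copies (with_proj (path_graph k)) T) / real (subtree_count k T)"

definition star_proportion :: "nat \<Rightarrow> ('a, 'b) pre_digraph \<Rightarrow> real" where
  "star_proportion k T =
     real (induced_copies (with_proj (star_graph k)) T) / real (subtree_count k T)"

end

theory Submission
  imports Defs
begin

text \<open>
  Write \<open>n\<close>, \<open>D\<close>, \<open>Z\<close>, \<open>S\<close>, \<open>P\<close> for the number of vertices, the sum of \<open>d(v)\<^sup>k\<^sup>-\<^sup>1\<close>, and the numbers of
  \<open>k\<close>-vertex subtrees, stars and paths. Since \<open>S\<close> is the sum of the binomials \<open>d(v)\<close> over \<open>k - 1\<close>, \<open>D\<close> is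
  at most a constant times \<open>S + n\<close>. Growing a subtree from a vertex \<open>v\<close> of maximal degree leaves at most
  \<open>k d(v)\<close> choices in every step, so \<open>Z\<close> is at most a constant times \<open>D\<close>. Hence \<open>Z/n\<close> and \<open>D/n\<close> tend to
  infinity together.

  A subtree that is not a star contains \<open>v \<rightarrow> w \<rightarrow> x\<close> with \<open>x\<close> not adjacent to \<open>v\<close>, so one of the growing
  steps has only \<open>d(w)\<close> choices. If \<open>d(w)\<close> is much smaller than \<open>d(v)\<close>, this gains a small factor.
  Otherwise the edge \<open>vw\<close> joins vertices of comparable degrees, and as a tree has fewer edges than
  vertices, such edges are charged to their lower ends in a rooting and cost only a sum of \<open>d(v)\<^sup>k\<^sup>-\<^sup>2\<close>.
  So \<open>Z - S\<close> is at most \<open>\<epsilon> D + C n\<close> for every \<open>\<epsilon> > 0\<close>, and \<open>D/n \<rightarrow> \<infinity>\<close> forces \<open>S/Z \<rightarrow> 1\<close>, hence \<open>P/Z \<rightarrow> 0\<close>.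

  Conversely, suppose that \<open>D \<le> K n\<close> and let \<open>m\<close> be the maximal degree. If some vertex is not the end of
  a path on \<open>k\<close> vertices, then the tree has radius at most \<open>k - 2\<close>, so \<open>n\<close> is at most \<open>(1 + m)\<^sup>k\<^sup>-\<^sup>2\<close>,
  whereas \<open>D\<close> is at least \<open>m\<^sup>k\<^sup>-\<^sup>1\<close>; this bounds \<open>m\<close> and therefore \<open>n\<close>. So for large \<open>n\<close> we have
  \<open>n \<le> k P\<close>, and \<open>P/Z\<close> stays away from \<open>0\<close>.
\<close>

section \<open>Isomorphisms and induced subgraphs\<close>

text \<open>Library isomorphisms also map arcs. The later arguments use only the vertex map, whose
  injectivity carries adjacency back from \<open>H\<close> to \<open>G\<close>.\<close>

lemma digraph_iso_dominates:
  assumes "digraph_iso G H"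
  obtains f where "bij_betw f (verts G) (verts H)"
    and "\<And>u v. u \<in> verts G \<Longrightarrow> v \<in> verts G \<Longrightarrow> u \<rightarrow>\<^bsub>G\<^esub> v \<longleftrightarrow> f u \<rightarrow>\<^bsub>H\<^esub> f v"
proof -
  from assms obtain h where h: "pre_digraph.digraph_isomorphism G h" and H: "H = app_iso h G"
    unfolding digraph_iso_def by blast
  have wf: "wf_digraph G" and inj: "inj_on (iso_verts h) (verts G)"
    using h by (auto simp: pre_digraph.digraph_isomorphism_def)
  have ends: "arcs_ends H = (\<lambda>(u,v). (iso_verts h u, iso_verts h v)) ` arcs_ends G"
    unfolding H by (rule wf_digraph.arcs_ends_app_iso_eq[OF wf h])
  show thesis
  proof
    show "bij_betw (iso_verts h) (verts G) (verts H)"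
      using inj by (simp add: H bij_betw_def)
    fix u v assume uv: "u \<in> verts G" "v \<in> verts G"
    show "u \<rightarrow>\<^bsub>G\<^esub> v \<longleftrightarrow> iso_verts h u \<rightarrow>\<^bsub>H\<^esub> iso_verts h v"
    proof
      assume "iso_verts h u \<rightarrow>\<^bsub>H\<^esub> iso_verts h v"
      then obtain x y where xy: "x \<rightarrow>\<^bsub>G\<^esub> y" "iso_verts h u = iso_verts h x" "iso_verts h v = iso_verts h y"
        unfolding ends by auto
      then show "u \<rightarrow>\<^bsub>G\<^esub> v"
        using inj uv wf_digraph.adj_in_verts[OF wf xy(1)] by (metis inj_onD)
    qed (auto simp: ends)
  qed
qed

text \<open>As \<open>G\<close> has no parallel arcs and the arcs of \<open>H\<close> are pairs of
  vertices, the vertex map alone determines the arc map and makes it injective.\<close>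

lemma digraph_iso_with_projI:
  assumes "nomulti_digraph G" and "pair_wf_digraph H"
    and f: "bij_betw f (verts G) (pverts H)"
    and adj: "\<And>u v. u \<in> verts G \<Longrightarrow> v \<in> verts G \<Longrightarrow> u \<rightarrow>\<^bsub>G\<^esub> v \<longleftrightarrow> (f u, f v) \<in> parcs H"
  shows "digraph_iso G (with_proj H)"
proof -
  interpret G: nomulti_digraph G by fact
  interpret H: pair_wf_digraph H by fact
  define h where "h = \<lparr> iso_verts = f, iso_arcs = (\<lambda>a. (f (tail G a), f (head G a))),
    iso_head = snd, iso_tail = fst \<rparr>"
  have inj: "inj_on f (verts G)" using f by (simp add: bij_betw_def)
  have "inj_on (\<lambda>a. (f (tail G a), f (head G a))) (arcs G)"
  proof (rule inj_onI)
    fix a b assume ab: "a \<in> arcs G" "b \<in> arcs G"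
      and "(f (tail G a), f (head G a)) = (f (tail G b), f (head G b))"
    then have "tail G a = tail G b" "head G a = head G b"
      using inj ab by (auto simp: inj_on_eq_iff)
    then show "a = b" using G.no_multi_arcs[OF ab] by (simp add: arc_to_ends_def)
  qed
  then have "pre_digraph.digraph_isomorphism G h"
    using inj G.wf_digraph by (simp add: pre_digraph.digraph_isomorphism_def h_def)
  moreover have "(\<lambda>a. (f (tail G a), f (head G a))) ` arcs G = parcs H"
  proof (intro equalityI subsetI)
    fix p assume "p \<in> (\<lambda>a. (f (tail G a), f (head G a))) ` arcs G"
    then obtain a where a: "a \<in> arcs G" "p = (f (tail G a), f (head G a))" by blast
    then have "tail G a \<rightarrow>\<^bsub>G\<^esub> head G a" by (auto simp: arcs_ends_conv)
    then show "p \<in> parcs H" using a adj by simp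
  next
    fix p assume p: "p \<in> parcs H"
    obtain x y where xy: "p = (x, y)" by fastforce
    then have "x \<in> f ` verts G" "y \<in> f ` verts G"
      using f p H.wellformed' by (auto simp: bij_betw_def)
    then obtain u v where "u \<in> verts G" "v \<in> verts G" "x = f u" "y = f v" by blast
    moreover from this have "u \<rightarrow>\<^bsub>G\<^esub> v" using adj p xy by simp
    ultimately show "p \<in> (\<lambda>a. (f (tail G a), f (head G a))) ` arcs G"
      using xy by (auto simp: arcs_ends_conv)
  qed
  then have "app_iso h G = with_proj H"
    using f by (simp add: app_iso_def h_def with_proj_def bij_betw_def)
  ultimately show ?thesis unfolding digraph_iso_def by metis
qed

lemma dominates_induce_iff: "u \<rightarrow>\<^bsub>G \<restriction> U\<^esub> v \<longleftrightarrow> u \<rightarrow>\<^bsub>G\<^esub> v \<and> u \<in> U \<and> v \<in> U"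
  by (auto simp: arcs_ends_conv)

lemma (in graph) graph_induce:
  assumes "U \<subseteq> verts G" shows "graph (G \<restriction> U)"
proof -
  have *: "induced_subgraph (G \<restriction> U) G" using assms by (rule induced_induce)
  show ?thesis
    using digraphI_induced[OF *] induced_graph_imp_symmetric[OF sym_arcs *] by (rule digraph.graphI)
qed

lemma (in graph) adj_sym: "u \<rightarrow>\<^bsub>G\<^esub> v \<Longrightarrow> v \<rightarrow>\<^bsub>G\<^esub> u"
  by (rule graph_symmetric)

lemma (in graph) connected_iff_reachable:
  "Digraph_Component.connected G \<longleftrightarrow> verts G \<noteq> {} \<and> (\<forall>u\<in>verts G. \<forall>v\<in>verts G. u \<rightarrow>\<^sup>* v)"
  by (simp add: Digraph_Component.connected_def strongly_connected_def
      reachable_mk_symmetric_eq[OF sym_arcs])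

lemma (in graph) connectedI_center:
  assumes "v \<in> verts G" and "\<And>u. u \<in> verts G \<Longrightarrow> v \<rightarrow>\<^sup>* u"
  shows "Digraph_Component.connected G"
  unfolding connected_iff_reachable
  using assms by (blast intro: reachable_trans symmetric_reachable')

definition nbrs :: "('a, 'b) pre_digraph \<Rightarrow> 'a \<Rightarrow> 'a set" where
  "nbrs G v = {w. v \<rightarrow>\<^bsub>G\<^esub> w}"

context graph
begin

lemma nbrs_subset: "nbrs G v \<subseteq> verts G"
  by (auto simp: nbrs_def dest: adj_in_verts)

lemma finite_nbrs [simp]: "finite (nbrs G v)"
  using nbrs_subset by (rule finite_subset) simp

text \<open>The degree counts arcs. In the absence of parallel arcs, taking heads sends the arcs out
  of \<open>v\<close> injectively to its neighbours.\<close>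

lemma card_nbrs: "card (nbrs G v) = out_degree G v"
proof -
  have "nbrs G v = head G ` out_arcs G v"
    by (force simp: nbrs_def arcs_ends_conv)
  moreover have "inj_on (head G) (out_arcs G v)"
    by (auto intro!: inj_onI no_multi_arcs simp: arc_to_ends_def)
  ultimately show ?thesis by (simp add: out_degree_def card_image)
qed

lemma nbrs_irrefl: "v \<notin> nbrs G v"
  by (auto simp: nbrs_def dest: adj_not_same)

definition path :: "'a list \<Rightarrow> bool" where
  "path p \<longleftrightarrow> p \<noteq> [] \<and> distinct p \<and> successively (\<lambda>u v. u \<rightarrow>\<^bsub>G\<^esub> v) p \<and> set p \<subseteq> verts G"

lemma path_Cons:
  "path (y # p) \<longleftrightarrow> (p = [] \<and> y \<in> verts G) \<or> (path p \<and> y \<notin> set p \<and> y \<rightarrow>\<^bsub>G\<^esub> hd p)"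
  by (cases p) (auto simp: path_def dest: adj_in_verts)

lemma path_suffix: "path (p @ q) \<Longrightarrow> q \<noteq> [] \<Longrightarrow> path q"
  by (auto simp: path_def successively_append_iff)

lemma path_prefix: "path (p @ q) \<Longrightarrow> p \<noteq> [] \<Longrightarrow> path p"
  by (auto simp: path_def successively_append_iff)

lemma length_path_le: "path p \<Longrightarrow> length p \<le> card (verts G)"
  by (metis path_def distinct_card card_mono finite_verts)

text \<open>Bridge from vertex lists to the arc walks in which \<open>cycle\<close>, and hence
  \<open>is_tree\<close>, is phrased.\<close>

lemma awalk_of_successively:
  assumes "successively (\<lambda>u v. u \<rightarrow>\<^bsub>G\<^esub> v) q" "q \<noteq> []" "set q \<subseteq> verts G"
  shows "\<exists>es. awalk (hd q) es (last q) \<and> awalk_verts (hd q) es = q"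
  using assms
proof (induction q)
  case (Cons u q)
  show ?case
  proof (cases q)
    case Nil
    then show ?thesis using Cons.prems by (auto intro!: exI[of _ "[]"] simp: awalk_Nil_iff)
  next
    case (Cons v r)
    then obtain es where es: "awalk v es (last q)" "awalk_verts v es = q"
      using Cons.IH Cons.prems by auto
    have "u \<rightarrow>\<^bsub>G\<^esub> v" using Cons.prems Cons by simp
    then obtain e where "e \<in> arcs G" "tail G e = u" "head G e = v" by auto
    then show ?thesis
      using es Cons by (intro exI[of _ "e # es"]) (auto simp: awalk_Cons_iff)
  qed
qed simp

end


section \<open>Trees\<close>

locale undirected_tree = graph G for G :: "('a, 'b) pre_digraph" (structure) +
  assumes is_tree_G: "is_tree G"
begin

lemma verts_nonempty: "verts G \<noteq> {}"
  using is_tree_G connected_iff_reachable by (auto simp: is_tree_def)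

text \<open>Acyclicity passes to subgraphs, so only connectedness has to be checked.\<close>

lemma is_tree_induce_iff:
  assumes "U \<subseteq> verts G"
  shows "is_tree (G \<restriction> U) \<longleftrightarrow> Digraph_Component.connected (G \<restriction> U)"
  using assms is_tree_G graph_induce[OF assms]
    subgraph_cycle[OF subgraph_induce_subgraphI[OF assms]]
  by (auto simp: is_tree_def)

text \<open>The arc from the last vertex back to the first closes the path to a cycle with
  \<open>length p\<close> arcs.\<close>

lemma no_closed_path:
  assumes "path p" "3 \<le> length p" "last p \<rightarrow>\<^bsub>G\<^esub> hd p"
  shows False
proof -
  let ?q = "p @ [hd p]"
  have p: "p \<noteq> []" "distinct p" "successively (\<lambda>u v. u \<rightarrow>\<^bsub>G\<^esub> v) p" "set p \<subseteq> verts G"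
    using assms(1) by (auto simp: path_def)
  have hd: "hd p \<in> verts G" using p by auto
  obtain es where es: "awalk (hd ?q) es (last ?q)" "awalk_verts (hd ?q) es = ?q"
    using awalk_of_successively[of ?q] p assms(3) hd by (auto simp: successively_append_iff)
  have "length es = length p" using es(2) length_awalk_verts[of "hd ?q" es] by simp
  moreover have "distinct (tl ?q)"
    using p(1,2) by (cases p) auto
  ultimately have "cycle es" using es assms(2) p(1) by (auto simp: cycle_def)
  then show False
    using is_tree_G assms(2) \<open>length es = length p\<close> by (auto simp: is_tree_def)
qed

lemma no_triangle:
  assumes "u \<rightarrow>\<^bsub>G\<^esub> v" "v \<rightarrow>\<^bsub>G\<^esub> w" "u \<rightarrow>\<^bsub>G\<^esub> w" shows False
proof (rule no_closed_path[of "[u, v, w]"])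
  show "path [u, v, w]"
    using assms by (auto simp: path_def dest: adj_in_verts adj_not_same)
  show "last [u, v, w] \<rightarrow>\<^bsub>G\<^esub> hd [u, v, w]" using assms by (auto intro: adj_sym)
qed simp

text \<open>Otherwise the chord and the stretch of the path between its ends would form a closed
  path.\<close>

lemma path_no_chord:
  assumes "path (p @ u # q @ w # r)" "u \<rightarrow>\<^bsub>G\<^esub> w"
  shows "q = []"
proof (rule ccontr)
  assume "q \<noteq> []"
  have "path (u # q @ [w])"
    using path_prefix[of "u # q @ [w]" r] path_suffix[of p "(u # q @ [w]) @ r"] assms(1) by simp
  then show False
    using no_closed_path[of "u # q @ [w]"] \<open>q \<noteq> []\<close> assms(2)
    by (cases q) (auto intro: adj_sym)
qed

text \<open>The first vertex of a longest path inside \<open>W\<close> works: by maximality its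
  neighbours in \<open>W\<close> lie on the path, and the absence of chords leaves only the second
  vertex.\<close>

lemma ex_low_degree_vertex:
  assumes "W \<subseteq> verts G" "W \<noteq> {}"
  obtains u where "u \<in> W" "\<And>y z. y \<in> W \<Longrightarrow> z \<in> W \<Longrightarrow> u \<rightarrow>\<^bsub>G\<^esub> y \<Longrightarrow> u \<rightarrow>\<^bsub>G\<^esub> z \<Longrightarrow> y = z"
proof -
  let ?P = "\<lambda>p. path p \<and> set p \<subseteq> W"
  obtain w where "w \<in> W" using assms by blast
  then have "?P [w]" using assms by (auto simp: path_def)
  moreover have "\<forall>p. ?P p \<longrightarrow> length p < Suc (card (verts G))"
    by (auto dest: length_path_le)
  ultimately obtain p where p: "?P p" and max: "\<And>q. ?P q \<Longrightarrow> length q \<le> length p"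
    using ex_has_greatest_nat[of ?P "[w]" length "Suc (card (verts G))"] by blast
  obtain u q where q: "p = u # q" using p by (cases p) (auto simp: path_def)
  have in_p: "y \<in> set q" if "y \<in> W" "u \<rightarrow>\<^bsub>G\<^esub> y" for y
  proof (rule ccontr)
    assume "y \<notin> set q"
    moreover have "y \<noteq> u" using that by (auto dest: adj_not_same)
    ultimately have "?P (y # p)"
      using that p q adj_sym[OF that(2)] by (simp add: path_Cons[of y "u # q"])
    then show False using max[of "y # p"] by simp
  qed
  have fst: "y = hd q" if y: "y \<in> W" "u \<rightarrow>\<^bsub>G\<^esub> y" for y
  proof -
    obtain q1 q2 where "q = q1 @ y # q2" using in_p[OF y] by (meson split_list)
    then show ?thesis using path_no_chord[of "[]" u q1 y q2] p q y by auto
  qed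
  show thesis
  proof (rule that)
    show "u \<in> W" using p q by simp
    show "y = z" if "y \<in> W" "z \<in> W" "u \<rightarrow>\<^bsub>G\<^esub> y" "u \<rightarrow>\<^bsub>G\<^esub> z" for y z
      using fst[OF that(1,3)] fst[OF that(2,4)] by (rule trans[OF _ sym])
  qed
qed

text \<open>Choosing a root orients every edge from child to parent. Only this sparsity property of trees
  is needed; it is obtained without a root by repeatedly removing a leaf.\<close>

lemma ex_parent_function_on:
  assumes "W \<subseteq> verts G"
  shows "\<exists>par. \<forall>u\<in>W. \<forall>v\<in>W. u \<rightarrow>\<^bsub>G\<^esub> v \<longrightarrow> par u = v \<or> par v = u"
proof -
  have "finite W" using assms by (rule finite_subset) simp
  then show ?thesis using assms
  proof (induction W rule: finite_psubset_induct)
    case (psubset W)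
    show ?case
    proof (cases "W = {}")
      case False
      then obtain u where u: "u \<in> W"
        and uniq: "\<And>y z. y \<in> W \<Longrightarrow> z \<in> W \<Longrightarrow> u \<rightarrow>\<^bsub>G\<^esub> y \<Longrightarrow> u \<rightarrow>\<^bsub>G\<^esub> z \<Longrightarrow> y = z"
        using ex_low_degree_vertex[OF psubset.prems] by blast
      obtain par where par: "\<forall>v\<in>W - {u}. \<forall>w\<in>W - {u}. v \<rightarrow>\<^bsub>G\<^esub> w \<longrightarrow> par v = w \<or> par w = v"
        using psubset.IH[of "W - {u}"] u psubset.prems by blast
      \<comment> \<open>The parent of \<open>u\<close> is its only neighbour in \<open>W\<close>. If
        there is none, the choice is arbitrary and no edge at \<open>u\<close> has to be
        covered.\<close>
      let ?par = "par(u := (SOME y. y \<in> W \<and> u \<rightarrow>\<^bsub>G\<^esub> y))"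
      have *: "?par u = y" if "y \<in> W" "u \<rightarrow>\<^bsub>G\<^esub> y" for y
        using uniq that by auto
      have "?par v = w \<or> ?par w = v" if vw: "v \<in> W" "w \<in> W" "v \<rightarrow>\<^bsub>G\<^esub> w" for v w
      proof (cases "v = u \<or> w = u")
        case True
        then show ?thesis using *[of w] *[of v] vw adj_sym[OF vw(3)] by blast
      next
        case False
        then show ?thesis using par vw by auto
      qed
      then show ?thesis by blast
    qed simp
  qed
qed

lemma ex_parent_function:
  obtains par where "\<And>u v. u \<rightarrow>\<^bsub>G\<^esub> v \<Longrightarrow> par u = v \<or> par v = u"
proof -
  obtain par where par: "\<forall>u\<in>verts G. \<forall>v\<in>verts G. u \<rightarrow>\<^bsub>G\<^esub> v \<longrightarrow> par u = v \<or> par v = u"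
    using ex_parent_function_on[of "verts G"] by blast
  have "par u = v \<or> par v = u" if "u \<rightarrow>\<^bsub>G\<^esub> v" for u v
    using par that adj_in_verts[OF that] by blast
  then show thesis using that by blast
qed

text \<open>A walk inside \<open>U\<close> from \<open>A\<close> to its complement has to leave
  \<open>A\<close> somewhere. This is the single step by which subtrees are grown.\<close>

lemma subtree_cut_edge:
  assumes "is_tree (G \<restriction> U)" "A \<subseteq> U" "A \<noteq> {}" "A \<noteq> U"
  obtains x y where "x \<in> A" "y \<in> U - A" "x \<rightarrow>\<^bsub>G\<^esub> y"
proof -
  interpret U: graph "G \<restriction> U" using assms(1) by (simp add: is_tree_def)
  obtain a b where ab: "a \<in> A" "b \<in> U - A" using assms by blast
  then have "a \<rightarrow>\<^sup>*\<^bsub>G \<restriction> U\<^esub> b"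
    using assms U.connected_iff_reachable by (auto simp: is_tree_def)
  then have "b \<in> A \<or> (\<exists>x\<in>A. \<exists>y\<in>U - A. x \<rightarrow>\<^bsub>G\<^esub> y)"
  proof (induction rule: U.reachable_induct)
    case (step x y)
    then show ?case by (auto simp: dominates_induce_iff)
  qed (use ab in simp)
  then show thesis using ab that by blast
qed

end


section \<open>Counting subtrees\<close>

context undirected_tree
begin

abbreviation deg :: "'a \<Rightarrow> nat" where
  "deg \<equiv> out_degree G"

definition subtrees :: "nat \<Rightarrow> 'a set set" where
  "subtrees k = {U. U \<subseteq> verts G \<and> card U = k \<and> is_tree (G \<restriction> U)}"

text \<open>No isomorphism is mentioned: since a tree has no triangles, a common neighbour
  \<open>v\<close> of all other vertices already forces the shape of a star.\<close>

definition stars :: "nat \<Rightarrow> 'a set set" where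
  "stars k = {U. U \<subseteq> verts G \<and> card U = k \<and> (\<exists>v\<in>U. U \<subseteq> insert v (nbrs G v))}"

definition paths :: "nat \<Rightarrow> 'a set set" where
  "paths k = {U. U \<subseteq> verts G \<and> is_tree (G \<restriction> U) \<and> digraph_iso (G \<restriction> U) (with_proj (path_graph k))}"

lemma finite_subtrees [simp]: "finite (subtrees k)"
  by (rule finite_subset[of _ "Pow (verts G)"]) (auto simp: subtrees_def)

lemma finite_stars [simp]: "finite (stars k)"
  by (rule finite_subset[of _ "Pow (verts G)"]) (auto simp: stars_def)

section \<open>Upper bounds by growing subtrees vertex by vertex\<close>

text \<open>Each of the \<open>j\<close> growing steps follows an edge out of the current set. Its
  inner end has at most \<open>card A + j\<close> choices, the final size, which stays fixed during
  the induction, and its outer end has at most \<open>m\<close>.\<close>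

lemma card_subtrees_superset:
  assumes "A \<subseteq> verts G" "A \<noteq> {}"
  shows "card {U \<in> subtrees (card A + j). A \<subseteq> U \<and> (\<forall>u\<in>U. deg u \<le> m)} \<le> ((card A + j) * m) ^ j"
    (is "card (?F A j) \<le> _")
  using assms
proof (induction j arbitrary: A)
  case 0
  have "?F A 0 \<subseteq> {A}"
    by (auto simp: subtrees_def) (metis card_subset_eq finite_subset finite_verts)+
  then have "card (?F A 0) \<le> card {A}" by (intro card_mono) auto
  then show ?case by simp
next
  case (Suc j)
  \<comment> \<open>A vertex of \<open>A\<close> also lies in \<open>U\<close>, so its degree is at
    most \<open>m\<close>. Restricting to such vertices provides the bound on the outer end without
    assuming anything about \<open>A\<close>.\<close>
  let ?I = "{x \<in> A. deg x \<le> m}"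
  have fin: "finite A" using Suc.prems(1) by (rule finite_subset) simp
  have "?F A (Suc j) \<subseteq> (\<Union>x\<in>?I. \<Union>y\<in>nbrs G x - A. ?F (insert y A) j)"
  proof
    fix U assume U: "U \<in> ?F A (Suc j)"
    then have "A \<noteq> U" by (auto simp: subtrees_def)
    then obtain x y where xy: "x \<in> A" "y \<in> U - A" "x \<rightarrow>\<^bsub>G\<^esub> y"
      using subtree_cut_edge[of U A] U Suc.prems by (auto simp: subtrees_def)
    then have "U \<in> ?F (insert y A) j" "x \<in> ?I" "y \<in> nbrs G x - A"
      using U fin by (auto simp: nbrs_def)
    then show "U \<in> (\<Union>x\<in>?I. \<Union>y\<in>nbrs G x - A. ?F (insert y A) j)" by blast
  qed
  then have "card (?F A (Suc j)) \<le> card (\<Union>x\<in>?I. \<Union>y\<in>nbrs G x - A. ?F (insert y A) j)"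
    using fin by (intro card_mono) auto
  also have "\<dots> \<le> (\<Sum>x\<in>?I. card (\<Union>y\<in>nbrs G x - A. ?F (insert y A) j))"
    using fin by (intro card_UN_le) auto
  also have "\<dots> \<le> (\<Sum>x\<in>?I. m * ((card A + Suc j) * m) ^ j)"
  proof (rule sum_mono)
    fix x assume x: "x \<in> ?I"
    have "card (\<Union>y\<in>nbrs G x - A. ?F (insert y A) j) \<le> (\<Sum>y\<in>nbrs G x - A. card (?F (insert y A) j))"
      by (intro card_UN_le) auto
    also have "\<dots> \<le> (\<Sum>y\<in>nbrs G x - A. ((card A + Suc j) * m) ^ j)"
    proof (rule sum_mono)
      fix y assume y: "y \<in> nbrs G x - A"
      then have "insert y A \<subseteq> verts G" using Suc.prems nbrs_subset by blast
      then show "card (?F (insert y A) j) \<le> ((card A + Suc j) * m) ^ j"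
        using Suc.IH[of "insert y A"] y fin by simp
    qed
    also have "\<dots> \<le> m * ((card A + Suc j) * m) ^ j"
      using x card_Diff_subset_Int[of "nbrs G x" A] card_mono[of "nbrs G x" "nbrs G x - A"]
      by (auto simp: card_nbrs)
    finally show "card (\<Union>y\<in>nbrs G x - A. ?F (insert y A) j) \<le> m * ((card A + Suc j) * m) ^ j" .
  qed
  also have "\<dots> \<le> (card A + Suc j) * (m * ((card A + Suc j) * m) ^ j)"
    using card_mono[OF fin, of ?I] by (simp only: sum_constant of_nat_id) (rule mult_right_mono, auto)
  also have "\<dots> = ((card A + Suc j) * m) ^ Suc j" by (simp only: power_Suc mult.assoc)
  finally show ?case .
qed

lemma ex_max_degree_vertex:
  assumes "U \<in> subtrees k" "k > 0"
  obtains v where "v \<in> U" "\<And>u. u \<in> U \<Longrightarrow> deg u \<le> deg v"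
proof -
  have "finite U" "U \<noteq> {}"
    using assms by (auto simp: subtrees_def intro: card_ge_0_finite)
  then have "Max (deg ` U) \<in> deg ` U" and "\<forall>u\<in>U. deg u \<le> Max (deg ` U)" by auto
  then obtain v where "v \<in> U" "\<forall>u\<in>U. deg u \<le> deg v" by fastforce
  then show thesis using that by blast
qed

text \<open>Every subtree is grown from a vertex \<open>v\<close> of maximal degree in it, so that
  \<open>deg v\<close> bounds the degrees met in all \<open>k - 1\<close> steps.\<close>

lemma card_subtrees_le:
  assumes "k > 0"
  shows "card (subtrees k) \<le> (\<Sum>v\<in>verts G. (k * deg v) ^ (k - 1))"
proof -
  let ?F = "\<lambda>v. {U \<in> subtrees (card {v} + (k - 1)). {v} \<subseteq> U \<and> (\<forall>u\<in>U. deg u \<le> deg v)}"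
  have k: "card {v} + (k - 1) = k" for v :: 'a using assms by simp
  have "subtrees k \<subseteq> (\<Union>v\<in>verts G. ?F v)"
  proof
    fix U assume U: "U \<in> subtrees k"
    then obtain v where v: "v \<in> U" "\<And>u. u \<in> U \<Longrightarrow> deg u \<le> deg v"
      using ex_max_degree_vertex assms by blast
    moreover have "v \<in> verts G" using U v by (auto simp: subtrees_def)
    ultimately show "U \<in> (\<Union>v\<in>verts G. ?F v)" using U k by auto
  qed
  then have "card (subtrees k) \<le> card (\<Union>v\<in>verts G. ?F v)" by (intro card_mono) auto
  also have "\<dots> \<le> (\<Sum>v\<in>verts G. card (?F v))" by (intro card_UN_le) auto
  also have "\<dots> \<le> (\<Sum>v\<in>verts G. (k * deg v) ^ (k - 1))"
  proof (rule sum_mono)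
    fix v assume "v \<in> verts G"
    then have "card (?F v) \<le> ((card {v} + (k - 1)) * deg v) ^ (k - 1)"
      by (intro card_subtrees_superset) auto
    then show "card (?F v) \<le> (k * deg v) ^ (k - 1)" unfolding k .
  qed
  finally show ?thesis .
qed

text \<open>Let \<open>v\<close> have maximal degree in the subtree. As the subtree is not a star,
  an edge \<open>w\<close>, \<open>x\<close> leaves the closed neighbourhood of \<open>v\<close>.
  Given \<open>v\<close> and \<open>w\<close>, there are at most \<open>deg w\<close> choices for
  \<open>x\<close>, and the remaining \<open>k - 3\<close> vertices are grown as before.\<close>

lemma card_nonstar_subtrees_le:
  assumes "k \<ge> 3"
  shows "card (subtrees k - stars k)
    \<le> (\<Sum>v\<in>verts G. \<Sum>w | v \<rightarrow>\<^bsub>G\<^esub> w \<and> deg w \<le> deg v. deg w * (k * deg v) ^ (k - 3))"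
proof -
  let ?F = "\<lambda>v w x. {U \<in> subtrees (card {v, w, x} + (k - 3)). {v, w, x} \<subseteq> U \<and> (\<forall>u\<in>U. deg u \<le> deg v)}"
  let ?I = "\<lambda>v. {w. v \<rightarrow>\<^bsub>G\<^esub> w \<and> deg w \<le> deg v}"
  let ?J = "\<lambda>v w. nbrs G w - {v}"
  have finI: "finite (?I v)" for v
    by (rule finite_subset[OF _ finite_nbrs[of v]]) (auto simp: nbrs_def)
  have sub: "subtrees k - stars k \<subseteq> (\<Union>v\<in>verts G. \<Union>w\<in>?I v. \<Union>x\<in>?J v w. ?F v w x)"
  proof
    fix U assume U: "U \<in> subtrees k - stars k"
    then have U': "U \<subseteq> verts G" "card U = k" "is_tree (G \<restriction> U)" by (auto simp: subtrees_def)
    obtain v where v: "v \<in> U" "\<And>u. u \<in> U \<Longrightarrow> deg u \<le> deg v"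
      using U ex_max_degree_vertex[of U k] assms by auto
    have "U \<inter> insert v (nbrs G v) \<noteq> U" using U v by (auto simp: stars_def subtrees_def)
    then obtain w x where w: "w \<in> U \<inter> insert v (nbrs G v)"
      and x: "x \<in> U - (U \<inter> insert v (nbrs G v))" and wx: "w \<rightarrow>\<^bsub>G\<^esub> x"
      using subtree_cut_edge[OF U'(3), of "U \<inter> insert v (nbrs G v)"] v by blast
    \<comment> \<open>The case \<open>w = v\<close> is impossible, since \<open>x\<close> would then
      be a neighbour of \<open>v\<close>.\<close>
    have vw: "v \<rightarrow>\<^bsub>G\<^esub> w" using w x wx by (auto simp: nbrs_def)
    have neq: "v \<noteq> w" "w \<noteq> x" "v \<noteq> x" using vw wx x by (auto dest: adj_not_same)
    then have "card {v, w, x} + (k - 3) = k" using assms by simp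
    then have "U \<in> ?F v w x" using U v w x by auto
    moreover have "v \<in> verts G" "w \<in> ?I v" "x \<in> ?J v w"
      using v w vw wx neq U' by (auto simp: nbrs_def)
    ultimately show "U \<in> (\<Union>v\<in>verts G. \<Union>w\<in>?I v. \<Union>x\<in>?J v w. ?F v w x)" by blast
  qed
  have "card (subtrees k - stars k) \<le> card (\<Union>v\<in>verts G. \<Union>w\<in>?I v. \<Union>x\<in>?J v w. ?F v w x)"
    using finI by (intro card_mono sub) auto
  also have "\<dots> \<le> (\<Sum>v\<in>verts G. card (\<Union>w\<in>?I v. \<Union>x\<in>?J v w. ?F v w x))"
    by (intro card_UN_le) auto
  also have "\<dots> \<le> (\<Sum>v\<in>verts G. \<Sum>w\<in>?I v. card (\<Union>x\<in>?J v w. ?F v w x))"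
    using finI by (intro sum_mono card_UN_le) auto
  also have "\<dots> \<le> (\<Sum>v\<in>verts G. \<Sum>w\<in>?I v. deg w * (k * deg v) ^ (k - 3))"
  proof (intro sum_mono)
    fix v w assume v: "v \<in> verts G" and w: "w \<in> ?I v"
    have "card (\<Union>x\<in>?J v w. ?F v w x) \<le> (\<Sum>x\<in>?J v w. card (?F v w x))"
      by (intro card_UN_le) auto
    also have "\<dots> \<le> (\<Sum>x\<in>?J v w. (k * deg v) ^ (k - 3))"
    proof (rule sum_mono)
      fix x assume x: "x \<in> ?J v w"
      then have wx: "w \<rightarrow>\<^bsub>G\<^esub> x" "x \<noteq> v" by (auto simp: nbrs_def)
      have "v \<noteq> w" "w \<noteq> x" using w wx by (auto dest: adj_not_same)
      then have "card {v, w, x} = 3" using wx(2) by simp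
      moreover have "{v, w, x} \<subseteq> verts G" using w wx by (auto dest: adj_in_verts)
      ultimately show "card (?F v w x) \<le> (k * deg v) ^ (k - 3)"
        using card_subtrees_superset[of "{v, w, x}" "k - 3" "deg v"] assms by simp
    qed
    also have "\<dots> \<le> deg w * (k * deg v) ^ (k - 3)"
      using card_mono[of "nbrs G w" "?J v w"] by (auto simp: card_nbrs)
    finally show "card (\<Union>x\<in>?J v w. ?F v w x) \<le> deg w * (k * deg v) ^ (k - 3)" .
  qed
  finally show ?thesis .
qed

section \<open>Stars and paths as induced copies\<close>

lemma star_is_tree:
  assumes "U \<subseteq> verts G" "v \<in> U" "U \<subseteq> insert v (nbrs G v)"
  shows "is_tree (G \<restriction> U)"
proof -
  interpret U: graph "G \<restriction> U" using assms(1) by (rule graph_induce)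
  have "Digraph_Component.connected (G \<restriction> U)"
  proof (rule U.connectedI_center)
    show "v \<in> verts (G \<restriction> U)" using assms by simp
    fix u assume "u \<in> verts (G \<restriction> U)"
    then have "u = v \<or> v \<rightarrow>\<^bsub>G \<restriction> U\<^esub> u"
      using assms by (auto simp: dominates_induce_iff nbrs_def)
    then show "v \<rightarrow>\<^sup>*\<^bsub>G \<restriction> U\<^esub> u" using assms(2) by auto
  qed
  then show ?thesis using assms(1) is_tree_induce_iff by simp
qed

text \<open>The centre is numbered 0 and the leaves in any order. Two leaves cannot be adjacent, as
  they would form a triangle with the centre.\<close>

lemma star_iso:
  assumes "U \<subseteq> verts G" "v \<in> U" "U \<subseteq> insert v (nbrs G v)"
  shows "digraph_iso (G \<restriction> U) (with_proj (star_graph (card U)))"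
proof -
  interpret U: graph "G \<restriction> U" using assms(1) by (rule graph_induce)
  have fin: "finite U" using assms(1) by (rule finite_subset) simp
  then have k: "card U > 0" using assms(2) by (auto simp: card_gt_0_iff)
  have "card (U - {v}) = card {1..<card U}" using assms(2) fin by simp
  then obtain g where g: "bij_betw g (U - {v}) {1..<card U}"
    using fin by (metis bij_betw_iff_card finite_Diff finite_atLeastLessThan)
  define f where "f = g(v := 0)"
  have "bij_betw f (U - {v}) {1..<card U}"
    using g by (rule bij_betw_cong[THEN iffD1, rotated]) (simp add: f_def)
  then have "bij_betw f (U - {v} \<union> {v}) ({1..<card U} \<union> {f v})"
    by (intro notIn_Un_bij_betw) (auto simp: f_def)
  moreover have "{1..<card U} \<union> {f v} = {..<card U}" using k by (auto simp: f_def)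
  ultimately have f: "bij_betw f U {..<card U}" using assms(2) by (simp add: insert_absorb)
  have f0: "f u = 0 \<longleftrightarrow> u = v" if "u \<in> U" for u
    using f assms(2) that by (metis bij_betw_def f_def fun_upd_same inj_onD)
  show ?thesis
  proof (rule digraph_iso_with_projI[where f = f])
    show "pair_wf_digraph (star_graph (card U))"
      by unfold_locales (auto simp: star_graph_def)
    show "bij_betw f (verts (G \<restriction> U)) (pverts (star_graph (card U)))"
      using f by (simp add: star_graph_def)
    fix x y assume xy: "x \<in> verts (G \<restriction> U)" "y \<in> verts (G \<restriction> U)"
    then have lt: "f x < card U" "f y < card U" using f by (auto dest: bij_betwE)
    have "f x = f y \<longleftrightarrow> x = y" using f xy by (auto simp: bij_betw_def inj_on_eq_iff)
    then have "(f x, f y) \<in> parcs (star_graph (card U)) \<longleftrightarrow> x \<noteq> y \<and> (x = v \<or> y = v)"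
      using lt xy f0 by (auto simp: star_graph_def)
    also have "\<dots> \<longleftrightarrow> x \<rightarrow>\<^bsub>G\<^esub> y"
    proof
      assume "x \<noteq> y \<and> (x = v \<or> y = v)"
      then show "x \<rightarrow>\<^bsub>G\<^esub> y" using assms(3) xy adj_sym by (auto simp: nbrs_def)
    next
      assume adj: "x \<rightarrow>\<^bsub>G\<^esub> y"
      have "x = v \<or> y = v"
      proof (rule ccontr)
        assume "\<not> (x = v \<or> y = v)"
        then have "v \<rightarrow>\<^bsub>G\<^esub> x" "v \<rightarrow>\<^bsub>G\<^esub> y" using assms(3) xy by (auto simp: nbrs_def)
        then show False using no_triangle adj by blast
      qed
      then show "x \<noteq> y \<and> (x = v \<or> y = v)" using adj adj_not_same by blast
    qed
    finally show "x \<rightarrow>\<^bsub>G \<restriction> U\<^esub> y \<longleftrightarrow> (f x, f y) \<in> parcs (star_graph (card U))"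
      using xy by (simp add: dominates_induce_iff)
  qed unfold_locales
qed

lemma star_iso_center:
  assumes iso: "digraph_iso (G \<restriction> U) (with_proj (star_graph k))" and "k > 0"
  obtains v where "v \<in> U" "U \<subseteq> insert v (nbrs G v)"
proof -
  obtain f where f: "bij_betw f U {..<k}"
    and adj: "\<And>u v. u \<in> U \<Longrightarrow> v \<in> U \<Longrightarrow> u \<rightarrow>\<^bsub>G \<restriction> U\<^esub> v \<longleftrightarrow> f u \<rightarrow>\<^bsub>with_proj (star_graph k)\<^esub> f v"
    using digraph_iso_dominates[OF iso] by (auto simp: star_graph_def)
  obtain v where v: "v \<in> U" "f v = 0"
    using f \<open>k > 0\<close> by (metis bij_betw_imp_surj_on imageE lessThan_iff)
  have "u \<in> nbrs G v" if u: "u \<in> U" "u \<noteq> v" for u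
  proof -
    have "f u \<noteq> f v" using f u v by (metis bij_betw_def inj_onD)
    moreover have "f u < k" using f u by (auto dest: bij_betwE)
    ultimately have "f u \<noteq> 0" "f u < k" using v by auto
    then have "f v \<rightarrow>\<^bsub>with_proj (star_graph k)\<^esub> f u"
      using v \<open>k > 0\<close> by (auto simp: star_graph_def)
    then show ?thesis using adj u v by (auto simp: nbrs_def dominates_induce_iff)
  qed
  then show thesis using v that by blast
qed

lemma digraph_iso_induce_card:
  assumes "digraph_iso (G \<restriction> U) (with_proj H)"
  shows "card U = card (pverts H)"
proof -
  obtain f where "bij_betw f (verts (G \<restriction> U)) (verts (with_proj H))"
    using digraph_iso_dominates[OF assms] by blast
  then show ?thesis by (auto dest: bij_betw_same_card)
qed

lemma stars_subset_subtrees: "stars k \<subseteq> subtrees k"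
  by (auto simp: stars_def subtrees_def intro: star_is_tree)

lemma star_copies:
  assumes "k > 0"
  shows "induced_copies (with_proj (star_graph k)) G = card (stars k)"
proof -
  have "{U. U \<subseteq> verts G \<and> is_tree (G \<restriction> U) \<and> digraph_iso (G \<restriction> U) (with_proj (star_graph k))} = stars k"
  proof (intro equalityI subsetI)
    fix U assume U: "U \<in> {U. U \<subseteq> verts G \<and> is_tree (G \<restriction> U) \<and>
      digraph_iso (G \<restriction> U) (with_proj (star_graph k))}"
    then obtain v where "v \<in> U" "U \<subseteq> insert v (nbrs G v)"
      using star_iso_center[OF _ assms] by blast
    moreover have "card U = card (pverts (star_graph k))"
      using U by (intro digraph_iso_induce_card) simp
    then have "card U = k" by (simp add: star_graph_def)
    ultimately show "U \<in> stars k" using U by (auto simp: stars_def)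
  qed (auto simp: stars_def intro: star_is_tree star_iso)
  then show ?thesis by (simp add: induced_copies_def)
qed

lemma path_copies: "induced_copies (with_proj (path_graph k)) G = card (paths k)"
  by (simp add: induced_copies_def paths_def)

lemma subtree_count_eq: "subtree_count k G = card (subtrees k)"
  by (simp add: subtree_count_def subtrees_def)

lemma paths_subset_subtrees: "paths k \<subseteq> subtrees k"
proof
  fix U assume U: "U \<in> paths k"
  then have "card U = card (pverts (path_graph k))"
    by (intro digraph_iso_induce_card) (simp add: paths_def)
  then have "card U = k" by (simp add: path_graph_def)
  then show "U \<in> subtrees k" using U by (simp add: paths_def subtrees_def)
qed

text \<open>The centre of a star is adjacent to all other vertices, whereas on a path with at least
  four vertices each vertex has another one two positions away. For \<open>k = 3\<close> the two
  shapes coincide.\<close>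

lemma paths_stars_disjoint:
  assumes "k \<ge> 4"
  shows "paths k \<inter> stars k = {}"
proof (rule ccontr)
  assume "paths k \<inter> stars k \<noteq> {}"
  then obtain U v where iso: "digraph_iso (G \<restriction> U) (with_proj (path_graph k))"
    and v: "v \<in> U" "U \<subseteq> insert v (nbrs G v)"
    by (auto simp: paths_def stars_def)
  obtain f where f: "bij_betw f U {..<k}"
    and adj: "\<And>u v. u \<in> U \<Longrightarrow> v \<in> U \<Longrightarrow> u \<rightarrow>\<^bsub>G \<restriction> U\<^esub> v \<longleftrightarrow> f u \<rightarrow>\<^bsub>with_proj (path_graph k)\<^esub> f v"
    using digraph_iso_dominates[OF iso] by (auto simp: path_graph_def)
  \<comment> \<open>Upward steps occur only from positions 0 and 1, so they end at position 3 at
    most, which exists because \<open>k\<close> is at least 4.\<close>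
  define j where "j = (if f v \<ge> 2 then f v - 2 else f v + 2)"
  have "f v < k" using f v by (auto dest: bij_betwE)
  then have "j < k" using assms by (auto simp: j_def)
  then obtain u where u: "u \<in> U" "f u = j"
    using f by (metis bij_betw_imp_surj_on imageE lessThan_iff)
  have "u \<noteq> v" using u by (auto simp: j_def split: if_splits)
  then have "v \<rightarrow>\<^bsub>G \<restriction> U\<^esub> u" using u v by (auto simp: nbrs_def dominates_induce_iff)
  then have "f v \<rightarrow>\<^bsub>with_proj (path_graph k)\<^esub> f u" using adj u v by blast
  then show False using u by (auto simp: path_graph_def j_def split: if_splits)
qed

lemma card_paths_add_stars_le:
  assumes "k \<ge> 4"
  shows "card (paths k) + card (stars k) \<le> card (subtrees k)"
proof -
  have "card (paths k) + card (stars k) = card (paths k \<union> stars k)"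
    using paths_stars_disjoint[OF assms] finite_subset[OF paths_subset_subtrees]
    by (simp add: card_Un_disjoint)
  also have "\<dots> \<le> card (subtrees k)"
    using paths_subset_subtrees stars_subset_subtrees by (intro card_mono) auto
  finally show ?thesis .
qed

section \<open>A lower bound for the number of stars\<close>

text \<open>Choosing \<open>k - 1\<close> neighbours of \<open>v\<close> gives a star with centre
  \<open>v\<close>. With at least two leaves the centre is unique, so different centres contribute
  disjoint families.\<close>

lemma sum_choose_le_card_stars:
  assumes "k \<ge> 3"
  shows "(\<Sum>v\<in>verts G. deg v choose (k - 1)) \<le> card (stars k)"
proof -
  define Q where "Q v = insert v ` {A. A \<subseteq> nbrs G v \<and> card A = k - 1}" for v
  have fin: "finite {A. A \<subseteq> nbrs G v \<and> card A = k - 1}" for v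
    by (rule finite_subset[of _ "Pow (nbrs G v)"]) auto
  have cardQ: "card (Q v) = deg v choose (k - 1)" for v
  proof -
    have "inj_on (insert v) {A. A \<subseteq> nbrs G v \<and> card A = k - 1}"
      using nbrs_irrefl[of v] by (intro inj_onI) (metis (no_types, lifting) insert_ident mem_Collect_eq subsetD)
    then show ?thesis by (simp add: Q_def card_image n_subsets card_nbrs)
  qed
  have disj: "Q v \<inter> Q w = {}" if "v \<noteq> w" for v w
  proof (rule ccontr)
    assume "Q v \<inter> Q w \<noteq> {}"
    then obtain U where "U \<in> Q v" "U \<in> Q w" by blast
    then obtain A where A: "A \<subseteq> nbrs G v" "card A = k - 1" "U = insert v A"
      by (auto simp: Q_def)
    obtain B where B: "B \<subseteq> nbrs G w" "U = insert w B" using \<open>U \<in> Q w\<close> by (auto simp: Q_def)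
    have eq: "insert v A = insert w B" using A B by simp
    have "w \<in> insert v A" unfolding eq by simp
    then have "w \<in> A" using that by simp
    \<comment> \<open>Since \<open>k - 1\<close> is at least 2, some leaf \<open>x\<close> differs
      from \<open>w\<close>, and \<open>v\<close>, \<open>w\<close>, \<open>x\<close> would form a
      triangle.\<close>
    have "\<not> A \<subseteq> {w}" using card_mono[of "{w}" A] A assms by auto
    then obtain x where x: "x \<in> A" "x \<noteq> w" by blast
    then have "x \<in> insert w B" using eq by (metis insertI2)
    then have "x \<in> B" using x by simp
    then have "v \<rightarrow>\<^bsub>G\<^esub> w" "v \<rightarrow>\<^bsub>G\<^esub> x" "w \<rightarrow>\<^bsub>G\<^esub> x" using A B x \<open>w \<in> A\<close> by (auto simp: nbrs_def)
    then show False using no_triangle by blast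
  qed
  have sub: "(\<Union>v\<in>verts G. Q v) \<subseteq> stars k"
  proof
    fix U assume "U \<in> (\<Union>v\<in>verts G. Q v)"
    then obtain v A where v: "v \<in> verts G" "A \<subseteq> nbrs G v" "card A = k - 1" "U = insert v A"
      by (auto simp: Q_def)
    have "v \<notin> A" using v nbrs_irrefl by blast
    moreover have "finite A" using v finite_nbrs finite_subset by blast
    ultimately show "U \<in> stars k" using v nbrs_subset assms by (auto simp: stars_def)
  qed
  have "(\<Sum>v\<in>verts G. deg v choose (k - 1)) = card (\<Union>v\<in>verts G. Q v)"
  proof -
    have "finite (Q v)" for v using fin by (simp add: Q_def)
    then show ?thesis using disj by (simp add: card_UN_disjoint cardQ)
  qed
  also have "\<dots> \<le> card (stars k)" by (intro card_mono sub) simp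
  finally show ?thesis .
qed

section \<open>Paths in a tree and a lower bound for their number\<close>

lemma path_is_tree:
  assumes "path p"
  shows "is_tree (G \<restriction> set p)"
proof -
  have sub: "set p \<subseteq> verts G" using assms by (simp add: path_def)
  interpret U: graph "G \<restriction> set p" using sub by (rule graph_induce)
  \<comment> \<open>The claim concerns all paths \<open>q\<close> within \<open>set p\<close>, so
    that the induction can pass to tails while the induced subgraph stays fixed.\<close>
  have reach: "hd q \<rightarrow>\<^sup>*\<^bsub>G \<restriction> set p\<^esub> u" if "path q" "set q \<subseteq> set p" "u \<in> set q" for q u
    using that
  proof (induction q)
    case (Cons y q)
    show ?case
    proof (cases "u = y")
      case False
      then have u: "u \<in> set q" using Cons.prems by simp
      then have q: "path q" "y \<rightarrow>\<^bsub>G\<^esub> hd q" using Cons.prems(1) by (auto simp: path_Cons)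
      then have "hd q \<in> set q" by (simp add: path_def)
      then have "y \<rightarrow>\<^bsub>G \<restriction> set p\<^esub> hd q" using q Cons.prems by (auto simp: dominates_induce_iff)
      moreover have "hd q \<rightarrow>\<^sup>*\<^bsub>G \<restriction> set p\<^esub> u" using Cons.IH q u Cons.prems by simp
      ultimately show ?thesis by (simp add: U.adj_reachable_trans)
    qed (use Cons.prems in simp)
  qed simp
  have "Digraph_Component.connected (G \<restriction> set p)"
    by (rule U.connectedI_center[of "hd p"]) (use reach[OF assms] assms in \<open>auto simp: path_def\<close>)
  then show ?thesis using is_tree_induce_iff[OF sub] by simp
qed

text \<open>Splitting \<open>p\<close> at the positions \<open>i\<close> and \<open>j\<close> makes
  an edge between them a chord, so nothing can lie in between.\<close>

lemma path_adj_nth_iff: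
  assumes p: "path p" and ij: "i < j" "j < length p"
  shows "p ! i \<rightarrow>\<^bsub>G\<^esub> p ! j \<longleftrightarrow> j = Suc i"
proof
  assume adj: "p ! i \<rightarrow>\<^bsub>G\<^esub> p ! j"
  let ?r = "drop (Suc i) p"
  have j: "j - Suc i < length ?r" "?r ! (j - Suc i) = p ! j" using ij by auto
  have "p = take i p @ p ! i # ?r" using ij by (intro id_take_nth_drop) simp
  also have "?r = take (j - Suc i) ?r @ p ! j # drop (Suc (j - Suc i)) ?r"
    using id_take_nth_drop[OF j(1)] j(2) by simp
  finally have "take (j - Suc i) ?r = []"
    using path_no_chord[OF _ adj] p by metis
  then show "j = Suc i" using ij by auto
next
  assume "j = Suc i"
  then show "p ! i \<rightarrow>\<^bsub>G\<^esub> p ! j" using p ij by (auto simp: path_def successively_conv_nth)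
qed

lemma path_mem_paths:
  assumes p: "path p"
  shows "set p \<in> paths (length p)"
proof -
  have sub: "set p \<subseteq> verts G" and dist: "distinct p" using p by (auto simp: path_def)
  interpret U: graph "G \<restriction> set p" using sub by (rule graph_induce)
  have bij: "bij_betw ((!) p) {..<length p} (set p)" using dist by (intro bij_betw_nth) auto
  let ?f = "the_inv_into {..<length p} ((!) p)"
  have f: "?f (p ! i) = i" if "i < length p" for i
    using bij that by (intro the_inv_into_f_f) (auto simp: bij_betw_def)
  have "digraph_iso (G \<restriction> set p) (with_proj (path_graph (length p)))"
  proof (rule digraph_iso_with_projI[where f = ?f])
    show "pair_wf_digraph (path_graph (length p))"
      by unfold_locales (auto simp: path_graph_def)
    show "bij_betw ?f (verts (G \<restriction> set p)) (pverts (path_graph (length p)))"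
      using bij_betw_the_inv_into[OF bij] by (simp add: path_graph_def)
    fix x y assume "x \<in> verts (G \<restriction> set p)" "y \<in> verts (G \<restriction> set p)"
    then obtain i j where ij: "i < length p" "j < length p" "x = p ! i" "y = p ! j"
      by (auto simp: in_set_conv_nth)
    have "p ! i \<rightarrow>\<^bsub>G\<^esub> p ! j \<longleftrightarrow> j = Suc i \<or> i = Suc j"
      using path_adj_nth_iff[OF p, of i j] path_adj_nth_iff[OF p, of j i] ij adj_sym adj_not_same
      by (cases i j rule: linorder_cases) auto
    then show "x \<rightarrow>\<^bsub>G \<restriction> set p\<^esub> y \<longleftrightarrow> (?f x, ?f y) \<in> parcs (path_graph (length p))"
      using ij by (simp add: dominates_induce_iff f path_graph_def)
  qed unfold_locales
  then show ?thesis using path_is_tree[OF p] sub by (simp add: paths_def)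
qed

text \<open>At most \<open>(1 + m) ^ j\<close> vertices start a path to \<open>v\<close> with at
  most \<open>j + 1\<close> vertices. If no path ending in \<open>v\<close> were longer, these would
  be all vertices, contradicting \<open>big\<close>.\<close>

lemma ex_path_to:
  assumes v: "v \<in> verts G" and m: "\<And>u. u \<in> verts G \<Longrightarrow> deg u \<le> m"
    and big: "(1 + m) ^ j < card (verts G)"
  obtains p where "path p" "last p = v" "length p = j + 2"
proof -
  \<comment> \<open>The vertices within distance \<open>i\<close> of \<open>v\<close>: paths are
    read towards \<open>v\<close> and grow at the head, and \<open>Suc i\<close> vertices mean
    \<open>i\<close> edges.\<close>
  let ?X = "\<lambda>i. {hd p | p. path p \<and> last p = v \<and> length p \<le> Suc i}"
  have sub: "?X i \<subseteq> verts G" for i by (auto simp: path_def)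
  then have fin: "finite (?X i)" for i by (rule finite_subset) simp
  have card: "card (?X i) \<le> (1 + m) ^ i" for i
  proof (induction i)
    case 0
    have "?X 0 \<subseteq> {v}" by (auto simp: path_def) (metis hd_conv_nth last_conv_nth length_0_conv le_Suc_eq diff_Suc_1 le_zero_eq)
    then show ?case using card_mono[of "{v}" "?X 0"] by simp
  next
    case (Suc i)
    have "?X (Suc i) \<subseteq> ?X i \<union> (\<Union>x\<in>?X i. nbrs G x)"
    proof
      fix y assume "y \<in> ?X (Suc i)"
      then obtain p where p: "y = hd p" "path p" "last p = v" "length p \<le> Suc (Suc i)" by blast
      show "y \<in> ?X i \<union> (\<Union>x\<in>?X i. nbrs G x)"
      proof (cases "length p \<le> Suc i")
        case False
        then obtain q where "p = y # q" using p by (cases p) auto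
        moreover from this False have "q \<noteq> []" by auto
        ultimately have q: "p = y # q" "q \<noteq> []" by auto
        then have "path q" "y \<rightarrow>\<^bsub>G\<^esub> hd q" using p(2) by (auto simp: path_Cons)
        then have "y \<in> nbrs G (hd q)" "path q" by (simp_all add: nbrs_def adj_sym)
        moreover have "last q = v" "length q \<le> Suc i"
          using p(3,4) q(2) unfolding q(1) by simp_all
        then have "hd q \<in> ?X i"
          using \<open>path q\<close> by (intro CollectI exI[of _ q]) simp
        ultimately show ?thesis by blast
      qed (use p in auto)
    qed
    then have "card (?X (Suc i)) \<le> card (?X i \<union> (\<Union>x\<in>?X i. nbrs G x))"
      using fin by (intro card_mono) auto
    also have "\<dots> \<le> card (?X i) + card (\<Union>x\<in>?X i. nbrs G x)" by (rule card_Un_le)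
    also have "card (\<Union>x\<in>?X i. nbrs G x) \<le> (\<Sum>x\<in>?X i. card (nbrs G x))"
      using fin by (intro card_UN_le) auto
    also have "\<dots> \<le> (\<Sum>x\<in>?X i. m)"
      using m sub by (intro sum_mono) (auto simp: card_nbrs)
    also have "card (?X i) + (\<Sum>x\<in>?X i. m) = card (?X i) * (1 + m)" by simp
    also have "\<dots> \<le> (1 + m) ^ i * (1 + m)" by (rule mult_right_mono[OF Suc.IH]) simp
    finally show ?case by (simp add: algebra_simps)
  qed
  have "\<exists>p. path p \<and> last p = v \<and> Suc j < length p"
  proof (rule ccontr)
    assume no: "\<not> (\<exists>p. path p \<and> last p = v \<and> Suc j < length p)"
    have short: "length p \<le> Suc j" if "path p" "last p = v" for p
      by (rule leI) (use no that in blast)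
    have "w \<in> ?X j" if "v \<rightarrow>\<^sup>* w" for w
      using that
    proof (induction rule: reachable_induct)
      case base
      have "path [v]" using v by (simp add: path_def)
      then show ?case by force
    next
      case (step x y)
      then obtain p where p: "x = hd p" "path p" "last p = v" by blast
      show ?case
      proof (cases "y \<in> set p")
        \<comment> \<open>A vertex already on the path starts a suffix of it, which is itself a path
          to \<open>v\<close>.\<close>
        case True
        then obtain q r where "p = q @ y # r" by (meson split_list)
        then have "path (y # r)" "last (y # r) = v" using p path_suffix by auto
        then show ?thesis using short by force
      next
        case False
        then have "path (y # p)" "last (y # p) = v"
          using p False adj_sym[OF step(2)] by (auto simp: path_Cons) (auto simp: path_def)
        then show ?thesis using short by force
      qed
    qed
    then have "verts G \<subseteq> ?X j"
      using is_tree_G v connected_iff_reachable by (auto simp: is_tree_def)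
    then have "card (verts G) \<le> (1 + m) ^ j" using card_mono[OF fin] card le_trans by blast
    then show False using big by simp
  qed
  then obtain p where p: "path p" "last p = v" "Suc j < length p" by blast
  \<comment> \<open>Cutting from the head preserves the end \<open>v\<close> and leaves exactly
    \<open>j + 2\<close> vertices.\<close>
  let ?q = "drop (length p - (j + 2)) p"
  have "path ?q" using path_suffix[of "take (length p - (j + 2)) p" ?q] p by simp
  moreover have "last ?q = v" "length ?q = j + 2" using p by auto
  ultimately show thesis by (rule that)
qed

text \<open>Every vertex ends a path with \<open>j + 2\<close> vertices, and each such path covers
  only \<open>j + 2\<close> vertices.\<close>

lemma card_verts_le_card_paths:
  assumes "\<And>u. u \<in> verts G \<Longrightarrow> deg u \<le> m" and "(1 + m) ^ j < card (verts G)"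
  shows "card (verts G) \<le> (j + 2) * card (paths (j + 2))"
proof -
  have fin: "finite (paths (j + 2))" by (rule finite_subset[OF paths_subset_subtrees]) simp
  have "verts G \<subseteq> \<Union> (paths (j + 2))"
  proof
    fix v assume "v \<in> verts G"
    then obtain p where p: "path p" "last p = v" "length p = j + 2" using ex_path_to assms by blast
    then have "v \<in> set p" by (auto simp: path_def)
    then show "v \<in> \<Union> (paths (j + 2))" using path_mem_paths[OF p(1)] p(3) by auto
  qed
  then have "card (verts G) \<le> card (\<Union>U\<in>paths (j + 2). U)"
    using fin by (intro card_mono) (auto simp: paths_def intro: finite_subset)
  also have "\<dots> \<le> (\<Sum>U\<in>paths (j + 2). card U)" using fin by (rule card_UN_le)
  also have "\<dots> = (\<Sum>U\<in>paths (j + 2). j + 2)"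
    using paths_subset_subtrees[of "j + 2"] by (intro sum.cong) (auto simp: subtrees_def)
  finally show ?thesis by (simp add: mult.commute)
qed

end


section \<open>Estimates by power sums of degrees\<close>

text \<open>For \<open>d\<close> at least \<open>m\<close> this follows from the bound of
  \<open>d choose m\<close> below by \<open>(d / m) ^ m\<close>. For smaller \<open>d\<close> the
  binomial vanishes and the summand 1 takes over.\<close>

lemma power_le_choose:
  assumes "m > 0"
  shows "real d ^ m \<le> real m ^ m * (real (d choose m) + 1)"
proof (cases "m \<le> d")
  case True
  have "real d ^ m = real m ^ m * (real d / real m) ^ m"
    using assms by (simp add: power_divide)
  also have "\<dots> \<le> real m ^ m * (real (d choose m) + 1)"
    using binomial_ge_n_over_k_pow_k[OF True, where 'a = real]
    by (intro mult_left_mono) auto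
  finally show ?thesis .
next
  case False
  then have "real d ^ m \<le> real m ^ m * 1" by (simp add: power_mono)
  also have "\<dots> \<le> real m ^ m * (real (d choose m) + 1)" by (intro mult_left_mono) auto
  finally show ?thesis .
qed

text \<open>Up to \<open>L\<close> the first summand suffices; beyond \<open>L\<close> the extra
  factor \<open>x / L\<close> exceeds 1.\<close>

lemma power_le_threshold:
  fixes x L :: real
  assumes "x \<ge> 0" "L > 0"
  shows "x ^ j \<le> L ^ j + x ^ Suc j / L"
proof (cases "x \<le> L")
  case True
  then have "x ^ j \<le> L ^ j" using assms by (intro power_mono)
  moreover have "x ^ Suc j / L \<ge> 0" using assms by simp
  ultimately show ?thesis by linarith
next
  case False
  then have "x ^ j * 1 \<le> x ^ j * (x / L)" using assms by (intro mult_left_mono) auto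
  moreover have "L ^ j \<ge> 0" using assms by simp
  ultimately show ?thesis by (simp add: mult.commute)
qed

context undirected_tree
begin

definition degree_power_sum :: "nat \<Rightarrow> real" where
  "degree_power_sum j = (\<Sum>v\<in>verts G. real (deg v) ^ j)"

lemma degree_power_sum_le_stars:
  assumes "k \<ge> 3"
  shows "degree_power_sum (k - 1) \<le> real (k - 1) ^ (k - 1) * (card (stars k) + card (verts G))"
proof -
  have "degree_power_sum (k - 1)
      \<le> (\<Sum>v\<in>verts G. real (k - 1) ^ (k - 1) * (real (deg v choose (k - 1)) + 1))"
    unfolding degree_power_sum_def using assms by (intro sum_mono power_le_choose) simp
  also have "\<dots> = real (k - 1) ^ (k - 1) *
      (real (\<Sum>v\<in>verts G. deg v choose (k - 1)) + card (verts G))"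
    by (simp add: sum_distrib_left[symmetric] sum.distrib)
  also have "\<dots> \<le> real (k - 1) ^ (k - 1) * (card (stars k) + card (verts G))"
    using of_nat_mono[OF sum_choose_le_card_stars[OF assms], where 'a = real]
    by (intro mult_left_mono add_right_mono) simp_all
  finally show ?thesis .
qed

lemma card_subtrees_le_degree_power_sum:
  assumes "k > 0"
  shows "card (subtrees k) \<le> real k ^ (k - 1) * degree_power_sum (k - 1)"
proof -
  have "real (card (subtrees k)) \<le> real (\<Sum>v\<in>verts G. (k * deg v) ^ (k - 1))"
    using card_subtrees_le[OF assms] by (rule of_nat_mono)
  then show ?thesis
    by (simp add: degree_power_sum_def power_mult_distrib sum_distrib_left)
qed

text \<open>Serves to trade a power sum of lower order for a small multiple of the next one, at the
  price of a term linear in the number of vertices.\<close>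

lemma degree_power_sum_lower:
  fixes L :: real
  assumes "L > 0"
  shows "degree_power_sum j \<le> L ^ j * card (verts G) + degree_power_sum (Suc j) / L"
proof -
  have "degree_power_sum j \<le> (\<Sum>v\<in>verts G. L ^ j + real (deg v) ^ Suc j / L)"
    unfolding degree_power_sum_def using assms by (intro sum_mono power_le_threshold) auto
  then show ?thesis
    by (simp add: degree_power_sum_def sum.distrib sum_divide_distrib mult.commute)
qed

text \<open>Edges whose end degrees differ by a factor of at least \<open>M\<close> contribute little. Any other edge
  is charged to its child, which costs only a power sum of lower order.\<close>

lemma sum_edges_le:
  fixes M :: real
  assumes "M \<ge> 1"
  shows "(\<Sum>v\<in>verts G. \<Sum>w | v \<rightarrow>\<^bsub>G\<^esub> w \<and> deg w \<le> deg v. real (deg w) * real (deg v) ^ j)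
    \<le> degree_power_sum (j + 2) / M + 2 * M ^ (j + 1) * degree_power_sum (j + 1)"
proof -
  obtain par where par: "\<And>u v. u \<rightarrow>\<^bsub>G\<^esub> v \<Longrightarrow> par u = v \<or> par v = u"
    using ex_parent_function by blast
  let ?d = "\<lambda>v. real (deg v)"
  \<comment> \<open>The term \<open>?a\<close> pays for edges with very unequal degrees, and
    \<open>?b v w\<close> is the charge to the child \<open>v\<close> of \<open>w\<close>.\<close>
  let ?a = "\<lambda>v w. if w \<in> nbrs G v then ?d v ^ (j + 1) / M else 0"
  let ?b = "\<lambda>v w. if par v = w then (M * ?d v) ^ (j + 1) else 0"
  have edge: "?d w * ?d v ^ j \<le> ?a v w + ?b v w + ?b w v"
    if "v \<rightarrow>\<^bsub>G\<^esub> w" and le: "deg w \<le> deg v" for v w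
  proof (cases "M * ?d w \<le> ?d v")
    case True
    then have "?d w \<le> ?d v / M" using assms by (simp add: field_simps)
    then have "?d w * ?d v ^ j \<le> ?d v / M * ?d v ^ j" by (intro mult_right_mono) auto
    then have "?d w * ?d v ^ j \<le> ?a v w" using that by (simp add: nbrs_def)
    moreover have "?b v w \<ge> 0" "?b w v \<ge> 0" using assms by auto
    ultimately show ?thesis by linarith
  next
    case False
    have "?d w * ?d v ^ j \<le> ?d v * ?d v ^ j" using le by (intro mult_right_mono) auto
    then have 1: "?d w * ?d v ^ j \<le> ?d v ^ (j + 1)" by simp
    have 2: "?d v ^ (j + 1) \<le> (M * ?d v) ^ (j + 1)"
      using mult_right_mono[of 1 M "?d v"] assms by (intro power_mono) auto
    \<comment> \<open>The degrees are comparable here, so the charge is large enough even if the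
      child is \<open>w\<close>, the end of smaller degree.\<close>
    have 3: "?d v ^ (j + 1) \<le> (M * ?d w) ^ (j + 1)"
      using False by (intro power_mono) auto
    have "?a v w \<ge> 0" "?b v w \<ge> 0" "?b w v \<ge> 0" using assms by auto
    moreover have "?d w * ?d v ^ j \<le> ?b v w \<or> ?d w * ?d v ^ j \<le> ?b w v"
      using par[OF that(1)] 1 2 3 by auto
    ultimately show ?thesis by linarith
  qed
  have fin: "finite {w. v \<rightarrow>\<^bsub>G\<^esub> w \<and> deg w \<le> deg v}" for v
    by (rule finite_subset[OF _ finite_nbrs[of v]]) (auto simp: nbrs_def)
  have nonneg: "?a v w + ?b v w + ?b w v \<ge> 0" for v w using assms by auto
  have "(\<Sum>v\<in>verts G. \<Sum>w | v \<rightarrow>\<^bsub>G\<^esub> w \<and> deg w \<le> deg v. ?d w * ?d v ^ j)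
      \<le> (\<Sum>v\<in>verts G. \<Sum>w | v \<rightarrow>\<^bsub>G\<^esub> w \<and> deg w \<le> deg v. ?a v w + ?b v w + ?b w v)"
    by (intro sum_mono edge) auto
  also have "\<dots> \<le> (\<Sum>v\<in>verts G. \<Sum>w\<in>verts G. ?a v w + ?b v w + ?b w v)"
    using adj_in_verts by (intro sum_mono sum_mono2 nonneg) auto
  also have "\<dots> = (\<Sum>v\<in>verts G. \<Sum>w\<in>verts G. ?a v w) + 2 * (\<Sum>v\<in>verts G. \<Sum>w\<in>verts G. ?b v w)"
    using sum.swap[of "\<lambda>v w. ?b w v" "verts G" "verts G"] by (simp add: sum.distrib)
  also have "(\<Sum>v\<in>verts G. \<Sum>w\<in>verts G. ?a v w) = degree_power_sum (j + 2) / M"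
  proof -
    have "(\<Sum>w\<in>verts G. ?a v w) = ?d v ^ (j + 2) / M" for v
    proof -
      have "(\<Sum>w\<in>verts G. ?a v w) = (\<Sum>w\<in>verts G \<inter> nbrs G v. ?d v ^ (j + 1) / M)"
        by (rule sum.inter_restrict[symmetric]) simp
      also have "verts G \<inter> nbrs G v = nbrs G v" using nbrs_subset by blast
      finally show ?thesis by (simp add: card_nbrs)
    qed
    then show ?thesis by (simp add: degree_power_sum_def sum_divide_distrib)
  qed
  \<comment> \<open>A vertex has only one parent, so each inner sum has at most one nonzero
    term.\<close>
  also have "(\<Sum>v\<in>verts G. \<Sum>w\<in>verts G. ?b v w) \<le> (\<Sum>v\<in>verts G. (M * ?d v) ^ (j + 1))"
    using assms by (intro sum_mono) simp
  also have "\<dots> = M ^ (j + 1) * degree_power_sum (j + 1)"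
    by (simp only: degree_power_sum_def power_mult_distrib sum_distrib_left)
  finally show ?thesis by (simp add: mult.assoc)
qed

lemma card_nonstar_subtrees_le_degree_power_sum:
  fixes M :: real
  assumes "k \<ge> 3" "M \<ge> 1"
  shows "card (subtrees k - stars k) \<le> real k ^ (k - 3) *
    (3 * degree_power_sum (k - 1) / M + 2 * M ^ (k - 2) * (M ^ (k - 1)) ^ (k - 2) * card (verts G))"
proof -
  obtain j where k: "k = j + 3" using assms(1) by (metis add.commute le_Suc_ex)
  let ?E = "\<Sum>v\<in>verts G. \<Sum>w | v \<rightarrow>\<^bsub>G\<^esub> w \<and> deg w \<le> deg v. real (deg w) * real (deg v) ^ j"
  \<comment> \<open>This threshold turns \<open>2 * M ^ (j + 1) / ?L\<close> into
    \<open>2 / M\<close>, which adds up with the first term to \<open>3 / M\<close>.\<close>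
  let ?L = "M ^ (j + 2)"
  have "real (card (subtrees k - stars k))
      \<le> real (\<Sum>v\<in>verts G. \<Sum>w | v \<rightarrow>\<^bsub>G\<^esub> w \<and> deg w \<le> deg v. deg w * (k * deg v) ^ (k - 3))"
    using card_nonstar_subtrees_le[OF assms(1)] by (rule of_nat_mono)
  also have "\<dots> = real k ^ j * ?E"
    by (simp add: k power_mult_distrib sum_distrib_left mult_ac)
  also have "?E \<le> degree_power_sum (j + 2) / M + 2 * M ^ (j + 1) * degree_power_sum (j + 1)"
    by (rule sum_edges_le) fact
  also have "\<dots> \<le> degree_power_sum (j + 2) / M + 2 * M ^ (j + 1) *
      (?L ^ (j + 1) * card (verts G) + degree_power_sum (j + 2) / ?L)"
    using degree_power_sum_lower[of ?L "j + 1"] assms(2)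
    by (intro add_left_mono mult_left_mono) auto
  also have "\<dots> = 3 * degree_power_sum (j + 2) / M + 2 * M ^ (j + 1) * ?L ^ (j + 1) * card (verts G)"
    using assms(2) by (simp add: field_simps)
  finally show ?thesis by (simp add: k mult_left_mono)
qed

text \<open>If the number of vertices were at most \<open>(1 + m) ^ (k - 2)\<close> for the maximal
  degree \<open>m\<close>, comparing \<open>m ^ (k - 1)\<close> with
  \<open>K * (2 * m) ^ (k - 2)\<close> would give \<open>m\<close> \<le>
  \<open>K * 2 ^ (k - 2)\<close>, contradicting \<open>big\<close>. Hence paths are long enough to
  cover all vertices.\<close>

lemma card_verts_le_paths_of_degree_power_sum:
  fixes K :: real
  assumes k: "k \<ge> 2" and K: "K \<ge> 0" and D: "degree_power_sum (k - 1) \<le> K * card (verts G)"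
    and big: "(1 + K * 2 ^ (k - 2)) ^ (k - 2) < card (verts G)"
  shows "card (verts G) \<le> k * card (paths k)"
proof -
  obtain j where j: "k = j + 2" using k by (metis add.commute le_Suc_ex)
  define m where "m = Max (deg ` verts G)"
  have "m \<in> deg ` verts G" unfolding m_def using verts_nonempty by (intro Max_in) auto
  then obtain u where u: "u \<in> verts G" "m = deg u" by blast
  have max: "deg v \<le> m" if "v \<in> verts G" for v using that by (simp add: m_def)
  have "(1 + m) ^ j < card (verts G)"
  proof (rule ccontr)
    assume "\<not> ?thesis"
    then have n: "real (card (verts G)) \<le> (1 + real m) ^ j"
      by (metis not_less of_nat_1 of_nat_add of_nat_le_iff of_nat_power)
    have "real m \<le> K * 2 ^ j"
    proof (cases "m = 0")
      case False
      have "real m ^ j * real m = real (deg u) ^ (k - 1)" using u by (simp add: j)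
      also have "\<dots> \<le> degree_power_sum (k - 1)"
        unfolding degree_power_sum_def using u(1) by (intro member_le_sum) auto
      also have "\<dots> \<le> K * (1 + real m) ^ j" using D mult_left_mono[OF n K] by linarith
      also have "\<dots> \<le> K * (2 * real m) ^ j"
        using False K by (intro mult_left_mono power_mono) auto
      also have "\<dots> = real m ^ j * (K * 2 ^ j)" by (simp add: power_mult_distrib)
      finally show ?thesis using False by simp
    qed (use K in simp)
    then have "(1 + real m) ^ j \<le> (1 + K * 2 ^ j) ^ j" by (intro power_mono) auto
    then show False using n big by (simp add: j)
  qed
  then show ?thesis using card_verts_le_card_paths[of m j] max j by auto
qed

end

section \<open>The limit argument\<close>

text \<open>The analytic part, into which trees enter only through inequalities uniform in
  \<open>i\<close>. The second and third statements imply each other, and the third, fourth and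
  first form a cycle of implications.\<close>

lemma limit_equivalences:
  fixes n D S Z P :: "nat \<Rightarrow> real" and c C q :: real
  assumes pos: "\<And>i. n i > 0" and lim: "filterlim n at_top sequentially"
    and nonneg: "\<And>i. P i \<ge> 0" "\<And>i. S i \<ge> 0"
    and const: "c > 0" "C > 0" "q > 0"
    and PSZ: "\<And>i. P i + S i \<le> Z i"
    and DS: "\<And>i. D i \<le> c * (S i + n i)"
    and ZD: "\<And>i. Z i \<le> C * D i"
    and nonstar: "\<And>e. e > 0 \<Longrightarrow> \<exists>B. \<forall>i. Z i - S i \<le> e * D i + B * n i"
    and long: "\<And>K. K > 0 \<Longrightarrow> \<exists>n0. \<forall>i. D i \<le> K * n i \<longrightarrow> n0 < n i \<longrightarrow> n i \<le> q * P i"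
  shows "(\<lambda>i. P i / Z i) \<longlonglongrightarrow> 0 \<longleftrightarrow> filterlim (\<lambda>i. Z i / n i) at_top sequentially"
    and "filterlim (\<lambda>i. Z i / n i) at_top sequentially \<longleftrightarrow> filterlim (\<lambda>i. D i / n i) at_top sequentially"
    and "filterlim (\<lambda>i. D i / n i) at_top sequentially \<longleftrightarrow> (\<lambda>i. S i / Z i) \<longlonglongrightarrow> 1"
proof -
  let ?M1 = "(\<lambda>i. P i / Z i) \<longlonglongrightarrow> 0" and ?M2 = "filterlim (\<lambda>i. Z i / n i) at_top sequentially"
    and ?M3 = "filterlim (\<lambda>i. D i / n i) at_top sequentially" and ?M4 = "(\<lambda>i. S i / Z i) \<longlonglongrightarrow> 1"
  have Z0: "Z i \<ge> 0" for i using PSZ[of i] nonneg[of i] by linarith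
  have 23: ?M3 if ?M2
    unfolding filterlim_at_top
  proof
    fix K
    have "\<forall>\<^sub>F i in sequentially. C * K \<le> Z i / n i" using that by (simp add: filterlim_at_top)
    then show "\<forall>\<^sub>F i in sequentially. K \<le> D i / n i"
    proof (rule eventually_mono)
      fix i assume "C * K \<le> Z i / n i"
      then have "C * (K * n i) \<le> C * D i" using ZD[of i] pos[of i] by (simp add: field_simps)
      then show "K \<le> D i / n i" using const pos[of i] by (simp add: field_simps)
    qed
  qed
  have 32: ?M2 if ?M3
    unfolding filterlim_at_top
  proof
    fix K
    \<comment> \<open>The additional 1 absorbs the summand \<open>n i\<close> of
      \<open>DS\<close>.\<close>
    have "\<forall>\<^sub>F i in sequentially. c * (K + 1) \<le> D i / n i" using that by (simp add: filterlim_at_top)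
    then show "\<forall>\<^sub>F i in sequentially. K \<le> Z i / n i"
    proof (rule eventually_mono)
      fix i assume "c * (K + 1) \<le> D i / n i"
      then have "c * ((K + 1) * n i) \<le> c * (S i + n i)"
        using DS[of i] pos[of i] by (simp add: field_simps)
      then have "(K + 1) * n i \<le> S i + n i" using const by simp
      then have "K * n i \<le> Z i" using PSZ[of i] nonneg[of i] by (simp add: algebra_simps)
      then show "K \<le> Z i / n i" using pos[of i] by (simp add: field_simps)
    qed
  qed
  have 34: ?M4 if ?M3
  proof (rule tendstoI)
    fix e :: real assume e: "e > 0"
    \<comment> \<open>As \<open>D i\<close> will be at most \<open>2 * c * Z i\<close>, the first
      term is at most half of \<open>e * Z i\<close>, and the other half is left for
      \<open>B * n i\<close>.\<close>
    obtain B where B: "Z i - S i \<le> e / (4 * c) * D i + B * n i" for i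
      using nonstar[of "e / (4 * c)"] e const by auto
    \<comment> \<open>The first summand makes \<open>B * n i\<close> smaller than
      \<open>e / (4 * c) * D i\<close>, the second makes \<open>2 * c * n i\<close> smaller than
      \<open>D i\<close>, and the 1 makes both strict.\<close>
    define K where "K = 4 * c * \<bar>B\<bar> / e + 2 * c + 1"
    have "\<forall>\<^sub>F i in sequentially. K \<le> D i / n i" using that by (simp add: filterlim_at_top)
    then show "\<forall>\<^sub>F i in sequentially. dist (S i / Z i) 1 < e"
    proof (rule eventually_mono)
      fix i assume "K \<le> D i / n i"
      then have KD: "K * n i \<le> D i" using pos[of i] by (simp add: field_simps)
      have "(4 * c * \<bar>B\<bar> / e) * n i \<ge> 0" "c * n i > 0" using e const pos[of i] by auto
      then have D1: "2 * (c * n i) < D i" and D2: "(4 * c * \<bar>B\<bar> / e) * n i < D i"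
        using KD pos[of i] by (auto simp: K_def algebra_simps)
      have "4 * c * (\<bar>B\<bar> * n i) < e * D i" using D2 e by (simp add: field_simps)
      moreover have "B * n i \<le> \<bar>B\<bar> * n i" using pos[of i] by (intro mult_right_mono) auto
      then have "4 * c * (B * n i) \<le> 4 * c * (\<bar>B\<bar> * n i)" using const by simp
      ultimately have "4 * c * (B * n i) < e * D i" by linarith
      moreover have "4 * c * (Z i - S i) \<le> e * D i + 4 * c * (B * n i)"
        using mult_left_mono[OF B[of i], of "4 * c"] const by (simp add: algebra_simps)
      ultimately have "2 * c * (Z i - S i) < e * D i" by (simp add: algebra_simps)
      also have "\<dots> \<le> e * (2 * c * Z i)"
      proof -
        have "S i \<le> Z i" using PSZ[of i] nonneg(1)[of i] by linarith
        then have "c * S i \<le> c * Z i" using const by simp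
        then have "D i \<le> c * Z i + c * n i" using DS[of i] unfolding distrib_left by linarith
        then have "D i \<le> 2 * c * Z i" using D1 by simp
        then show ?thesis using e by simp
      qed
      finally have "2 * c * (Z i - S i) < 2 * c * (e * Z i)" by (simp add: algebra_simps)
      then have ZS: "Z i - S i < e * Z i" using const by simp
      have "Z i - S i \<ge> 0" using PSZ[of i] nonneg[of i] by linarith
      \<comment> \<open>For \<open>Z i = 0\<close> the bound \<open>ZS\<close> would put a
        nonnegative number below 0.\<close>
      then have "Z i > 0" using ZS Z0[of i] e by (metis less_eq_real_def mult_zero_right not_le)
      then show "dist (S i / Z i) 1 < e"
        using ZS e \<open>Z i - S i \<ge> 0\<close> by (simp add: dist_real_def abs_if field_simps)
    qed
  qed
  have 41: ?M1 if ?M4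
  proof (rule tendsto_sandwich[of "\<lambda>_. 0"])
    show "\<forall>\<^sub>F i in sequentially. 0 \<le> P i / Z i" using nonneg Z0 by simp
    have "P i / Z i \<le> 1 - S i / Z i" for i
    \<comment> \<open>If \<open>Z i = 0\<close>, both quotients are 0 by convention and the claim
      reads 0 \<le> 1.\<close>
    proof (cases "Z i = 0")
      case False
      then have "Z i > 0" using Z0[of i] by simp
      then show ?thesis using PSZ[of i] by (simp add: field_simps)
    qed simp
    then show "\<forall>\<^sub>F i in sequentially. P i / Z i \<le> 1 - S i / Z i" by simp
    show "(\<lambda>i. 1 - S i / Z i) \<longlonglongrightarrow> 0" using tendsto_diff[OF tendsto_const that, of 1] by simp
  qed simp
  have 13: ?M3 if ?M1
    unfolding filterlim_at_top_gt[where c = 0]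
  proof (intro allI impI)
    fix K :: real assume K: "K > 0"
    obtain n0 where n0: "\<And>i. D i \<le> K * n i \<Longrightarrow> n0 < n i \<Longrightarrow> n i \<le> q * P i"
      using long[OF K] by blast
    \<comment> \<open>Whenever \<open>D i\<close> \<le> \<open>K * n i\<close> with
      \<open>n i\<close> large, \<open>Z i\<close> \<le> \<open>C * K * n i\<close> \<le>
      \<open>C * K * q * P i\<close>, so this is a lower bound for \<open>P i / Z i\<close>.\<close>
    have "1 / (C * K * q) > 0" using const K by simp
    then have "\<forall>\<^sub>F i in sequentially. P i / Z i < 1 / (C * K * q)"
      using that by (rule order_tendstoD(2)[rotated])
    moreover have "\<forall>\<^sub>F i in sequentially. n0 < n i"
      using lim by (simp add: filterlim_at_top_dense)
    ultimately show "\<forall>\<^sub>F i in sequentially. K \<le> D i / n i"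
    proof eventually_elim
      case (elim i)
      show ?case
      proof (rule ccontr)
        assume "\<not> ?thesis"
        then have D: "D i \<le> K * n i" using pos[of i] by (simp add: field_simps)
        then have nP: "n i \<le> q * P i" using n0 elim by blast
        then have "P i > 0" using pos[of i] const nonneg(1)[of i]
          by (metis less_eq_real_def mult_zero_right not_le)
        then have "Z i > 0" using PSZ[of i] nonneg(2)[of i] by linarith
        have "Z i \<le> C * (K * n i)" using ZD[of i] mult_left_mono[OF D, of C] const by linarith
        also have "\<dots> \<le> C * (K * (q * P i))" using nP const K by simp
        finally show False using elim(1) \<open>Z i > 0\<close> const K by (simp add: field_simps)
      qed
    qed
  qed
  show "?M1 \<longleftrightarrow> ?M2" using 13 32 23 34 41 by blast
  show "?M2 \<longleftrightarrow> ?M3" using 23 32 by blast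
  show "?M3 \<longleftrightarrow> ?M4" using 34 41 13 by blast
qed

theorem theorem1:
  fixes T :: "nat \<Rightarrow> ('a, 'b) pre_digraph" and k :: nat
  assumes "\<And>n. is_tree (T n)"
    and "filterlim (\<lambda>n. card (verts (T n))) at_top sequentially"
    and "k \<ge> 4"
  shows "let
      M1 = ((\<lambda>n. path_proportion k (T n)) \<longlonglongrightarrow> 0);
      M2 = filterlim (\<lambda>n. 1 / real (card (verts (T n))) * real (subtree_count k (T n)))
             at_top sequentially;
      M3 = filterlim (\<lambda>n. 1 / real (card (verts (T n))) *
             (\<Sum>v\<in>verts (T n). real (out_degree (T n) v) ^ (k - 1)))
             at_top sequentially;
      M4 = ((\<lambda>n. star_proportion k (T n)) \<longlonglongrightarrow> 1)
    in (M1 \<longleftrightarrow> M2) \<and> (M2 \<longleftrightarrow> M3) \<and> (M3 \<longleftrightarrow> M4)"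
proof -
  have tree: "undirected_tree (T i)" for i
    using assms(1) by (auto simp: undirected_tree_def undirected_tree_axioms_def is_tree_def)
  define n where "n i = real (card (verts (T i)))" for i
  define D where "D i = (\<Sum>v\<in>verts (T i). real (out_degree (T i) v) ^ (k - 1))" for i
  define S where "S i = real (induced_copies (with_proj (star_graph k)) (T i))" for i
  define P where "P i = real (induced_copies (with_proj (path_graph k)) (T i))" for i
  define Z where "Z i = real (subtree_count k (T i))" for i
  have D: "D i = undirected_tree.degree_power_sum (T i) (k - 1)" for i
    by (simp add: D_def undirected_tree.degree_power_sum_def[OF tree])
  have S: "S i = card (undirected_tree.stars (T i) k)" for i
    using assms(3) by (simp add: S_def undirected_tree.star_copies[OF tree])
  have P: "P i = card (undirected_tree.paths (T i) k)" for i
    by (simp add: P_def undirected_tree.path_copies[OF tree])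
  have Z: "Z i = card (undirected_tree.subtrees (T i) k)" for i
    by (simp add: Z_def undirected_tree.subtree_count_eq[OF tree])
  have pos: "n i > 0" for i
  proof -
    interpret undirected_tree "T i" by (rule tree)
    show ?thesis using verts_nonempty by (simp add: n_def card_gt_0_iff)
  qed
  have lim: "filterlim n at_top sequentially"
    unfolding n_def by (rule filterlim_compose[OF filterlim_real_sequentially assms(2)])
  have PSZ: "P i + S i \<le> Z i" for i
    using undirected_tree.card_paths_add_stars_le[OF tree assms(3), of i]
    by (simp add: P S Z flip: of_nat_add)
  have DS: "D i \<le> real (k - 1) ^ (k - 1) * (S i + n i)" for i
    using undirected_tree.degree_power_sum_le_stars[OF tree, of k i] assms(3)
    by (simp add: D S n_def)
  have ZD: "Z i \<le> real k ^ (k - 1) * D i" for i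
    using undirected_tree.card_subtrees_le_degree_power_sum[OF tree, of k i] assms(3)
    by (simp add: D Z)
  have nonstar: "\<exists>B. \<forall>i. Z i - S i \<le> e * D i + B * n i" if e: "e > 0" for e
  proof -
    \<comment> \<open>The second argument brings the coefficient of \<open>D i\<close> down to
      \<open>e\<close>; the first ensures \<open>M\<close> \<ge> 1. Both \<open>M\<close> and
      \<open>B\<close> depend only on \<open>e\<close> and \<open>k\<close>, hence are uniform in
      \<open>i\<close>.\<close>
    define M where "M = max 1 (3 * real k ^ (k - 3) / e)"
    define B where "B = real k ^ (k - 3) * (2 * M ^ (k - 2) * (M ^ (k - 1)) ^ (k - 2))"
    have M: "M \<ge> 1" "3 * real k ^ (k - 3) / M \<le> e"
    proof -
      show "M \<ge> 1" by (simp add: M_def)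
      have "3 * real k ^ (k - 3) / e \<le> M" by (simp add: M_def)
      then show "3 * real k ^ (k - 3) / M \<le> e" using e \<open>M \<ge> 1\<close> by (simp add: field_simps)
    qed
    have "Z i - S i \<le> e * D i + B * n i" for i
    proof -
      interpret undirected_tree "T i" by (rule tree)
      have "Z i - S i = card (subtrees k - stars k)"
        using stars_subset_subtrees by (simp add: Z S card_Diff_subset card_mono)
      also have "\<dots> \<le> real k ^ (k - 3) *
        (3 * D i / M + 2 * M ^ (k - 2) * (M ^ (k - 1)) ^ (k - 2) * n i)"
        using card_nonstar_subtrees_le_degree_power_sum[of k M] assms(3) M(1)
        by (simp add: D n_def)
      also have "\<dots> = 3 * real k ^ (k - 3) / M * D i + B * n i"
        by (simp add: B_def algebra_simps)
      also have "\<dots> \<le> e * D i + B * n i"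
        using M(2) by (intro add_right_mono mult_right_mono) (auto simp: D_def intro: sum_nonneg)
      finally show ?thesis .
    qed
    then show ?thesis by blast
  qed
  have long: "\<exists>n0. \<forall>i. D i \<le> K * n i \<longrightarrow> n0 < n i \<longrightarrow> n i \<le> real k * P i" if "K > 0" for K
  proof -
    have "n i \<le> real k * P i"
      if "D i \<le> K * n i" "(1 + K * 2 ^ (k - 2)) ^ (k - 2) < n i" for i
    proof -
      have "card (verts (T i)) \<le> k * card (undirected_tree.paths (T i) k)"
        using undirected_tree.card_verts_le_paths_of_degree_power_sum[OF tree, of k K i]
          that \<open>K > 0\<close> assms(3) by (simp add: D n_def)
      then show ?thesis by (simp add: n_def P flip: of_nat_mult)
    qed
    then show ?thesis by blast
  qed
  have c: "real (k - 1) ^ (k - 1) > 0" "real k ^ (k - 1) > 0" "real k > 0"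
    using assms(3) by auto
  have "P i \<ge> 0" "S i \<ge> 0" for i by (auto simp: P S)
  note equiv = limit_equivalences[OF pos lim this c PSZ DS ZD nonstar long]
  have "path_proportion k (T i) = P i / Z i" "star_proportion k (T i) = S i / Z i" for i
    by (simp_all add: path_proportion_def star_proportion_def P_def S_def Z_def)
  then show ?thesis
    using equiv unfolding Let_def D_def[symmetric] Z_def[symmetric] n_def[symmetric] by simp
qed

end
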